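(* If $G$ is a locally compact topological group, then $dd(G) = [d(G), w(G)]$; that is, for every cardinal $\lambda$, there is a dense subspace $D$ of $G$ with $d(D) = \lambda$ if and only if $d(G) \le \lambda \le w(G)$.
   Context: For a topological space $X$, $d(X)$ denotes its density (the least cardinality of a dense subset) and $w(X)$ its weight (the least cardinality of a base). The double density spectrum of $X$ is $dd(X) = \{d(D) : D \text{ is a dense subspace of } X\}$ (all dense subspaces, not only subgroups, are considered). For cardinals $\alpha \le \beta$, $[\alpha,\beta]$ denotes the set of all cardinals $\lambda$ with $\alpha \le \lambda \le \beta$. Topological groups are assumed Hausdorff. *)

theory Defs
  imports "HOL-Analysis.Analysis"
begin

unbundle cardinal_syntax

text \<open>
  Cardinals are rendered as in the HOL library, as cardinal orders \<open>r\<close> (\<open>Card_order r\<close>) compared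
  by \<open>\<le>o\<close> and identified up to \<open>=o\<close>.  The cardinality of a set \<open>A\<close> is \<open>|A|\<close>.
\<close>

text \<open>
  The least cardinality of a member of a nonempty family of sets.  The choice of the minimising
  member is irrelevant up to \<open>=o\<close>, as the lemmas below show.
\<close>

definition least_card :: "'a set set \<Rightarrow> 'a rel" where
  "least_card F = |SOME A. A \<in> F \<and> (\<forall>B\<in>F. |A| \<le>o |B| )|"

lemma least_card_minimiser:
  assumes "F \<noteq> {}"
  obtains A where "A \<in> F" and "least_card F = |A|" and "\<And>B. B \<in> F \<Longrightarrow> |A| \<le>o |B|"
proof -
  have "\<exists>r \<in> card_of ` F. \<forall>r' \<in> card_of ` F. r \<le>o r'"
    using assms by (intro exists_minim_Card_order) (auto simp: card_of_Card_order)
  then have "\<exists>A. A \<in> F \<and> (\<forall>B\<in>F. |A| \<le>o |B| )"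
    by auto
  from someI_ex[OF this] show thesis
    using that unfolding least_card_def by blast
qed

lemma least_card_unique:
  assumes "A \<in> F" and "\<And>B. B \<in> F \<Longrightarrow> |A| \<le>o |B|"
  shows "least_card F =o |A|"
proof -
  have "F \<noteq> {}" using assms(1) by blast
  then obtain C where "C \<in> F" "least_card F = |C|" "\<And>B. B \<in> F \<Longrightarrow> |C| \<le>o |B|"
    using least_card_minimiser by metis
  then show ?thesis
    using assms by (simp add: ordIso_iff_ordLeq)
qed

definition dense_in :: "'a topology \<Rightarrow> 'a set \<Rightarrow> bool" where
  "dense_in X D \<longleftrightarrow> D \<subseteq> topspace X \<and> X closure_of D = topspace X"

definition base_of_topology :: "'a topology \<Rightarrow> 'a set set \<Rightarrow> bool" where
  "base_of_topology X B \<longleftrightarrow>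
     (\<forall>V\<in>B. openin X V) \<and>
     (\<forall>U x. openin X U \<and> x \<in> U \<longrightarrow> (\<exists>V\<in>B. x \<in> V \<and> V \<subseteq> U))"

definition density_card :: "'a topology \<Rightarrow> 'a rel" where
  "density_card X = least_card {D. dense_in X D}"

definition weight_card :: "'a topology \<Rightarrow> 'a set rel" where
  "weight_card X = least_card {B. base_of_topology X B}"

lemma dense_in_topspace: "dense_in X (topspace X)"
  by (simp add: dense_in_def)

lemma base_of_topology_openin: "base_of_topology X {U. openin X U}"
  by (auto simp: base_of_topology_def)

text \<open>
  A set of HOL contains only cardinals living on one type, so the double density spectrum and
  the interval of cardinals are defined relative to an arbitrary type \<open>'b\<close>.  Both are closed
  under \<open>=o\<close>, so they are determined by the cardinals that they represent.
\<close>

definition dd_spectrum :: "'a topology \<Rightarrow> 'b rel set" where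
  "dd_spectrum X =
     {\<kappa>. Card_order \<kappa> \<and> (\<exists>D. dense_in X D \<and> density_card (subtopology X D) =o \<kappa>)}"

definition card_interval :: "'a rel \<Rightarrow> 'c rel \<Rightarrow> 'b rel set" where
  "card_interval \<alpha> \<beta> = {\<kappa>. Card_order \<kappa> \<and> \<alpha> \<le>o \<kappa> \<and> \<kappa> \<le>o \<beta>}"

end

theory Submission
  imports Defs
begin

text \<open>
  Only the case \<open>d(G) < \<kappa> \<le> w(G)\<close> needs an argument.  Fewer than \<open>\<kappa>\<close> neighbourhoods of \<open>0\<close> never
  intersect in \<open>{0}\<close>, since otherwise they would yield a base of fewer than \<open>\<kappa>\<close> sets.  Hence there
  is a strictly decreasing chain of compact subgroups \<open>N\<^sub>i\<close>, \<open>i < \<kappa>\<close>, taking intersections at limits,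
  and for each \<open>i\<close> a closed proper subset \<open>A\<^sub>i\<close> of \<open>G\<close> that is \<open>N\<^sub>i\<^sub>+\<^sub>1\<close>-invariant and meets every coset
  of \<open>N\<^sub>i\<close>.  The set \<open>P\<close> of the points lying in all but finitely many \<open>A\<^sub>i\<close> is dense: to reach an open
  set one has to give up only finitely many \<open>A\<^sub>i\<close>, because by compactness each requirement reduces
  to one on strictly smaller indices.  A dense subset of \<open>P\<close> has at least \<open>\<kappa>\<close> points, as fewer
  points would all lie in a single \<open>A\<^sub>i\<close>.  Conversely \<open>P\<close> has a subset \<open>Q\<close> with at most \<open>\<kappa>\<close> points that
  is dense modulo the compact subgroup \<open>N = \<Inter>N\<^sub>i\<close>; then every point \<open>e\<close> of a dense set of size \<open>d(G)\<close>
  lies in the closure of a translate \<open>Q - n\<close> with \<open>n \<in> N\<close>, and the union of these translates is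
  a dense subset of \<open>P\<close> with at most \<open>\<kappa>\<close> points.
\<close>

section \<open>Density, weight and cardinality\<close>

lemma dense_in_iff:
  "dense_in X D \<longleftrightarrow> D \<subseteq> topspace X \<and> (\<forall>U. openin X U \<and> U \<noteq> {} \<longrightarrow> D \<inter> U \<noteq> {})"
  by (simp add: dense_in_def dense_intersects_open)

lemma dense_in_euclidean_iff:
  "dense_in euclidean D \<longleftrightarrow> (\<forall>U. open U \<and> U \<noteq> {} \<longrightarrow> D \<inter> U \<noteq> {})"
  by (simp add: dense_in_iff)

text \<open>Density is transitive, so dense subsets of a dense subspace can be handled as dense sets
  of the whole space throughout.\<close>

lemma dense_in_subtopology_iff:
  assumes "dense_in X D"
  shows "dense_in (subtopology X D) D' \<longleftrightarrow> D' \<subseteq> D \<and> dense_in X D'"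
proof
  assume *: "dense_in (subtopology X D) D'"
  then have sub: "D' \<subseteq> D" by (auto simp: dense_in_iff)
  have "D' \<inter> U \<noteq> {}" if "openin X U" "U \<noteq> {}" for U
  proof -
    have "U \<inter> D \<noteq> {}" using assms that by (auto simp: dense_in_iff)
    moreover have "openin (subtopology X D) (U \<inter> D)" using that by (auto simp: openin_subtopology)
    ultimately show ?thesis using * by (fastforce simp: dense_in_iff)
  qed
  with sub assms show "D' \<subseteq> D \<and> dense_in X D'" by (auto simp: dense_in_iff)
next
  assume *: "D' \<subseteq> D \<and> dense_in X D'"
  have "D' \<inter> V \<noteq> {}" if V: "openin (subtopology X D) V" "V \<noteq> {}" for V
  proof -
    obtain U where "openin X U" "V = U \<inter> D" using V by (auto simp: openin_subtopology)
    then show ?thesis using * V by (fastforce simp: dense_in_iff)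
  qed
  with * assms show "dense_in (subtopology X D) D'" by (auto simp: dense_in_iff)
qed

lemma density_card_minimiser:
  obtains E where "dense_in X E" "density_card X = |E|" "\<And>D. dense_in X D \<Longrightarrow> |E| \<le>o |D|"
proof -
  have "{D. dense_in X D} \<noteq> {}" using dense_in_topspace by auto
  from least_card_minimiser[OF this] show ?thesis
    using that unfolding density_card_def by auto
qed

lemma weight_card_minimiser:
  obtains B where "base_of_topology X B" "weight_card X = |B|"
    "\<And>B'. base_of_topology X B' \<Longrightarrow> |B| \<le>o |B'|"
proof -
  have "{B. base_of_topology X B} \<noteq> {}" using base_of_topology_openin by auto
  from least_card_minimiser[OF this] show ?thesis
    using that unfolding weight_card_def by auto
qed

lemma density_card_le_subtopology:
  assumes "dense_in X D"
  shows "density_card X \<le>o density_card (subtopology X D)"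
proof -
  obtain E where "dense_in (subtopology X D) E" "density_card (subtopology X D) = |E|"
    using density_card_minimiser by metis
  then show ?thesis
    using density_card_minimiser[of X] dense_in_subtopology_iff[OF assms] by metis
qed

text \<open>One point of \<open>D\<close> in each nonempty member of a minimal base already forms a
  dense set. This gives the upper end of the interval.\<close>

lemma density_card_subtopology_le_weight:
  assumes "dense_in X D"
  shows "density_card (subtopology X D) \<le>o weight_card X"
proof -
  obtain B where B: "base_of_topology X B" "weight_card X = |B|"
    using weight_card_minimiser by metis
  define p where "p V = (SOME x. x \<in> V \<inter> D)" for V
  have p: "p V \<in> V \<inter> D" if "V \<in> B" "V \<noteq> {}" for V
  proof -
    have "\<exists>x. x \<in> V \<inter> D" using that assms B by (auto simp: dense_in_iff base_of_topology_def)
    then show ?thesis unfolding p_def by (rule someI_ex)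
  qed
  let ?P = "p ` (B - {{}})"
  have "dense_in X ?P"
    unfolding dense_in_iff
  proof (intro conjI allI impI)
    show "?P \<subseteq> topspace X"
      using p assms by (fastforce simp: dense_in_iff)
    fix U assume U: "openin X U \<and> U \<noteq> {}"
    then obtain x where "x \<in> U" by auto
    then obtain V where "V \<in> B" "x \<in> V" "V \<subseteq> U"
      using B U by (metis base_of_topology_def)
    then show "?P \<inter> U \<noteq> {}" using p[of V] by auto
  qed
  then have "dense_in (subtopology X D) ?P"
    using p dense_in_subtopology_iff[OF assms] by blast
  then have "density_card (subtopology X D) \<le>o |?P|"
    using density_card_minimiser by metis
  also have "|?P| \<le>o |B - {{}}|" by (rule card_of_image)
  also have "|B - {{}}| \<le>o |B|" by (rule card_of_mono1) auto
  finally show ?thesis using B by simp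
qed

lemma base_of_finite_t1:
  assumes "finite (UNIV :: 'a::t1_space set)"
  shows "base_of_topology euclidean (range (\<lambda>x::'a. {x}))"
proof -
  have "open {x}" for x :: 'a
  proof -
    have "closed (- {x})" using assms by (intro finite_imp_closed) (rule finite_subset[of _ UNIV], auto)
    then show ?thesis by (simp add: closed_def)
  qed
  then show ?thesis by (auto simp: base_of_topology_def)
qed

lemma dense_in_euclidean_finite:
  assumes "dense_in (euclidean :: 'a::t1_space topology) E" "finite E"
  shows "E = UNIV"
proof (rule ccontr)
  assume "E \<noteq> UNIV"
  then have "- E \<noteq> {}" "open (- E)" using assms(2) by (auto intro: finite_imp_closed)
  with assms(1) show False by (auto simp: dense_in_euclidean_iff)
qed

text \<open>Induction on \<open>n\<close> bounds the number of \<open>n\<close>-element subsets of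
  \<open>I\<close>; an infinite cardinal absorbs the countable union over \<open>n\<close>.\<close>

lemma card_Fpow_le:
  assumes "infinite C" "|I| \<le>o |C|"
  shows "|Fpow I| \<le>o |C|"
proof -
  have "|{F. F \<subseteq> I \<and> finite F \<and> card F = n}| \<le>o |C|" for n
  proof (induction n)
    case 0
    have "{F. F \<subseteq> I \<and> finite F \<and> card F = 0} = {{}}" by auto
    then show ?case using assms(1) by (metis card_of_singl_ordLeq finite.emptyI)
  next
    case (Suc n)
    let ?P = "{F. F \<subseteq> I \<and> finite F \<and> card F = n}"
    have "{F. F \<subseteq> I \<and> finite F \<and> card F = Suc n} \<subseteq> (\<lambda>(i, F). insert i F) ` (I \<times> ?P)"
    proof safe
      fix F assume F: "F \<subseteq> I" "finite F" "card F = Suc n"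
      then obtain i G where "F = insert i G" "i \<notin> G" "card G = n" "finite G"
        by (metis card_Suc_eq finite_insert)
      then show "F \<in> (\<lambda>(i, F). insert i F) ` (I \<times> ?P)" using F by (intro image_eqI[where x="(i, G)"]) auto
    qed
    then have "|{F. F \<subseteq> I \<and> finite F \<and> card F = Suc n}| \<le>o |(\<lambda>(i, F). insert i F) ` (I \<times> ?P)|"
      by (rule card_of_mono1)
    also have "|(\<lambda>(i, F). insert i F) ` (I \<times> ?P)| \<le>o |I \<times> ?P|" by (rule card_of_image)
    also have "|I \<times> ?P| \<le>o |C|" using assms Suc
      by (intro card_of_Times_ordLeq_infinite_Field) (auto simp: Field_card_of card_of_card_order_on)
    finally show ?case .
  qed
  moreover have "|UNIV :: nat set| \<le>o |C|" using assms(1) infinite_iff_card_of_nat by blast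
  ultimately have "|\<Union>n. {F. F \<subseteq> I \<and> finite F \<and> card F = n}| \<le>o |C|"
    by (intro card_of_UNION_ordLeq_infinite assms(1)) auto
  moreover have "(\<Union>n. {F. F \<subseteq> I \<and> finite F \<and> card F = n}) = Fpow I" by (auto simp: Fpow_def)
  ultimately show ?thesis by simp
qed

section \<open>Compact subgroups as intersections of neighbourhood sequences\<close>

lemma open_add_vimage:
  fixes U :: "'a::topological_group_add set"
  assumes "open U"
  shows "open {y. x + y \<in> U}" "open {y. y + x \<in> U}"
proof -
  have "open ((\<lambda>y. x + y) -` U)" "open ((\<lambda>y. y + x) -` U)"
    using assms by (intro open_vimage continuous_intros; simp)+
  then show "open {y. x + y \<in> U}" "open {y. y + x \<in> U}" by (simp_all add: vimage_def)
qed

lemma open_translate: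
  fixes U :: "'a::topological_group_add set"
  assumes "open U"
  shows "open ((+) x ` U)" "open ((\<lambda>y. y + x) ` U)"
proof -
  have "(+) x ` U = {y. - x + y \<in> U}"
    by (auto simp: image_iff) (metis add_minus_cancel)
  then show "open ((+) x ` U)" using open_add_vimage(1)[OF assms] by simp
  have "(\<lambda>y. y + x) ` U = {y. y + - x \<in> U}"
    by (auto simp: image_iff add.assoc) (metis diff_add_cancel)
  then show "open ((\<lambda>y. y + x) ` U)" using open_add_vimage(2)[OF assms, of "- x"] by simp
qed

lemma open_add_set:
  fixes U :: "'a::topological_group_add set"
  assumes "open U"
  shows "open {y + n | y n. y \<in> U \<and> n \<in> N}"
proof -
  have "{y + n | y n. y \<in> U \<and> n \<in> N} = (\<Union>n\<in>N. (\<lambda>y. y + n) ` U)" by auto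
  then show ?thesis using open_translate(2)[OF assms] by auto
qed

text \<open>The tube lemma, applied to the preimage of \<open>U\<close> under addition, thickens
  \<open>{x} \<times> N\<close> to an open tube.\<close>

lemma open_compact_translate:
  fixes U :: "'a::topological_group_add set"
  assumes "open U" "compact N"
  shows "open {y. \<forall>n\<in>N. y + n \<in> U}"
proof (subst open_subopen, safe)
  fix x assume x: "\<forall>n\<in>N. x + n \<in> U"
  let ?W = "(\<lambda>p. fst p + snd p) -` U"
  have "open ?W" using assms by (intro open_vimage continuous_intros)
  moreover have "{x} \<times> N \<subseteq> ?W" using x by auto
  ultimately obtain X where "x \<in> X" "open X" "X \<times> N \<subseteq> ?W"
    using Elementary_Topology.tube_lemma[OF assms(2), of ?W x] by metis
  then show "\<exists>T. open T \<and> x \<in> T \<and> T \<subseteq> {y. \<forall>n\<in>N. y + n \<in> U}"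
    by (intro exI[of _ X]) auto
qed

text \<open>Wallace's theorem encloses \<open>N \<times> N\<close> in an open box inside the
  preimage of \<open>U\<close> under the difference map; \<open>P\<close> is the intersection of the
  two sides.\<close>

lemma compact_difference_nbhd:
  fixes U :: "'a::topological_group_add set"
  assumes "open U" "compact N" "\<And>x y. x \<in> N \<Longrightarrow> y \<in> N \<Longrightarrow> - x + y \<in> U"
  obtains P where "open P" "N \<subseteq> P" "\<And>x y. x \<in> P \<Longrightarrow> y \<in> P \<Longrightarrow> - x + y \<in> U"
proof -
  let ?W = "(\<lambda>p. - fst p + snd p) -` U"
  have "open ?W" using assms by (intro open_vimage continuous_intros)
  moreover have "N \<times> N \<subseteq> ?W" using assms by auto
  ultimately obtain P Q where "open P" "open Q" "N \<subseteq> P" "N \<subseteq> Q" "P \<times> Q \<subseteq> ?W"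
    using Wallace_theorem_prod_topology[of euclidean N euclidean N ?W] assms(2) by auto
  then show ?thesis by (intro that[of "P \<inter> Q"]) auto
qed

text \<open>The conditions make the intersection of all \<open>S n\<close> a closed subgroup. Both
  differences are listed because addition need not commute.\<close>

definition nbhd_seq :: "(nat \<Rightarrow> 'a::topological_group_add set) \<Rightarrow> bool" where
  "nbhd_seq S \<longleftrightarrow> (\<forall>n. open (S n) \<and> 0 \<in> S n \<and>
     (\<forall>x\<in>S (Suc n). \<forall>y\<in>S (Suc n). x + y \<in> S n \<and> x - y \<in> S n \<and> - x + y \<in> S n))"

lemma nbhd_seq_exists:
  fixes U :: "'a::topological_group_add set"
  assumes "open U" "0 \<in> U"
  obtains S where "nbhd_seq S" "S 0 \<subseteq> U"
proof -
  have step: "\<exists>V. (open V \<and> 0 \<in> V) \<and> (\<forall>x\<in>V. \<forall>y\<in>V. x + y \<in> U \<and> x - y \<in> U \<and> - x + y \<in> U)"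
    if "open U" "0 \<in> U" for U :: "'a set"
  proof -
    let ?W = "(\<lambda>p. fst p + snd p) -` U \<inter> (\<lambda>p. fst p - snd p) -` U \<inter> (\<lambda>p. - fst p + snd p) -` U"
    have "open ?W" using that by (intro open_Int open_vimage continuous_intros)
    moreover have "(0, 0) \<in> ?W" using that by auto
    ultimately obtain A B where "open A" "open B" "(0,0) \<in> A \<times> B" "A \<times> B \<subseteq> ?W"
      by (rule open_prod_elim)
    then show ?thesis by (intro exI[of _ "A \<inter> B"]) auto
  qed
  \<comment> \<open>The clause for \<open>n = 0\<close> only starts the sequence inside
    \<open>U\<close>; the later sets are controlled by \<open>?Q\<close>.\<close>
  let ?P = "\<lambda>n (A :: 'a set). open A \<and> 0 \<in> A \<and> (n = (0::nat) \<longrightarrow> A \<subseteq> U)"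
  let ?Q = "\<lambda>(n::nat) (A :: 'a set) B. \<forall>x\<in>B. \<forall>y\<in>B. x + y \<in> A \<and> x - y \<in> A \<and> - x + y \<in> A"
  have "\<exists>S. \<forall>n. ?P n (S n) \<and> ?Q n (S n) (S (Suc n))"
  proof (rule dependent_nat_choice[of ?P ?Q])
    show "\<exists>A. ?P 0 A" using assms by blast
    show "\<exists>B. ?P (Suc n) B \<and> ?Q n A B" if "?P n A" for n A
      using step[of A] that by blast
  qed
  then obtain S where S: "\<forall>n. ?P n (S n) \<and> ?Q n (S n) (S (Suc n))" by (rule exE)
  show ?thesis
  proof (rule that)
    show "nbhd_seq S" unfolding nbhd_seq_def using S by simp
    show "S 0 \<subseteq> U" using S by simp
  qed
qed

lemma nbhd_seq_antimono:
  assumes "nbhd_seq S"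
  shows "antimono S"
proof -
  have "S (Suc n) \<subseteq> S n" for n
  proof
    fix x assume "x \<in> S (Suc n)"
    then have "x + 0 \<in> S n" using assms unfolding nbhd_seq_def by blast
    then show "x \<in> S n" by simp
  qed
  then show ?thesis by (metis antimonoI lift_Suc_antimono_le)
qed

text \<open>A point \<open>x\<close> of the closure has a neighbourhood \<open>x + S (Suc n)\<close>
  that meets \<open>S (Suc n)\<close>, so \<open>x\<close> is a difference of two elements of that
  set.\<close>

lemma nbhd_seq_closure:
  assumes "nbhd_seq S"
  shows "closure (S (Suc n)) \<subseteq> S n"
proof
  fix x assume x: "x \<in> closure (S (Suc n))"
  have S: "open (S (Suc n))" "0 \<in> S (Suc n)" using assms by (auto simp: nbhd_seq_def)
  have "x \<in> (+) x ` S (Suc n)" using S by (auto intro: image_eqI[where x=0])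
  then have "S (Suc n) \<inter> (+) x ` S (Suc n) \<noteq> {}"
    using x open_translate(1)[OF S(1), of x] closure_iff_nhds_not_empty by blast
  then obtain w w' where w: "w \<in> S (Suc n)" "w' \<in> S (Suc n)" and "w' = x + w"
    by blast
  then have "x = w' - w" by (simp add: \<open>w' = x + w\<close>)
  then show "x \<in> S n" using assms w unfolding nbhd_seq_def by blast
qed

section \<open>Compact subgroups attached to sets of indices\<close>

locale nbhd_seq_family =
  fixes S0 :: "nat \<Rightarrow> 'a::{topological_group_add, t2_space} set"
    and S :: "'i \<Rightarrow> nat \<Rightarrow> 'a set"
  assumes S0: "nbhd_seq S0" and compact_S0: "compact (closure (S0 0))"
    and S: "nbhd_seq (S i)"
begin

text \<open>\<open>S0\<close> enters for every \<open>I\<close>, even the empty one, so that all the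
  subgroups \<open>N I\<close> lie in the compact set \<open>closure (S0 0)\<close>.\<close>

definition B :: "'i set \<Rightarrow> nat \<Rightarrow> 'a set" where
  "B I n = S0 n \<inter> (\<Inter>i\<in>I. S i n)"

definition N :: "'i set \<Rightarrow> 'a set" where
  "N I = (\<Inter>n. B I n)"

lemma open_B: "finite F \<Longrightarrow> open (B F n)"
  unfolding B_def using S0 S by (intro open_Int open_INT) (auto simp: nbhd_seq_def)

lemma B_mono: "F \<subseteq> I \<Longrightarrow> m \<le> n \<Longrightarrow> B I n \<subseteq> B F m"
  using antimonoD[OF nbhd_seq_antimono[OF S0], of m n] antimonoD[OF nbhd_seq_antimono[OF S], of m n]
  unfolding B_def by (intro Int_mono INF_superset_mono) auto

lemma N_subset_B: "F \<subseteq> I \<Longrightarrow> N I \<subseteq> B F n"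
  using B_mono[of F I n n] by (auto simp: N_def)

lemma N_antimono: "F \<subseteq> I \<Longrightarrow> N I \<subseteq> N F"
  using N_subset_B unfolding N_def[of F] by blast

lemma B_closed_add: "x \<in> B I (Suc n) \<Longrightarrow> y \<in> B I (Suc n) \<Longrightarrow> x + y \<in> B I n \<and> - x + y \<in> B I n"
  using S0 S by (auto simp: B_def nbhd_seq_def)

lemma zero_in_N: "0 \<in> N I"
  using S0 S by (auto simp: N_def B_def nbhd_seq_def)

lemma N_add: "x \<in> N I \<Longrightarrow> y \<in> N I \<Longrightarrow> x + y \<in> N I"
  using B_closed_add by (auto simp: N_def)

lemma N_minus: "x \<in> N I \<Longrightarrow> - x \<in> N I"
  using B_closed_add[of x I _ 0] zero_in_N[of I] by (auto simp: N_def)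

lemma N_minus_add: "x \<in> N I \<Longrightarrow> y \<in> N I \<Longrightarrow> - x + y \<in> N I"
  by (simp add: N_add N_minus)

text \<open>The closure of each stage lies in the preceding stage, so passing to closures does not
  change the intersection. Closedness and compactness of \<open>N I\<close> follow.\<close>

lemma N_eq_closures: "N I = (\<Inter>n. closure (S0 n) \<inter> (\<Inter>i\<in>I. closure (S i n)))"
proof
  show "N I \<subseteq> (\<Inter>n. closure (S0 n) \<inter> (\<Inter>i\<in>I. closure (S i n)))"
    unfolding N_def B_def by (intro INF_mono' Int_mono INF_superset_mono closure_subset subset_refl)
  show "(\<Inter>n. closure (S0 n) \<inter> (\<Inter>i\<in>I. closure (S i n))) \<subseteq> N I"
    unfolding N_def B_def
  proof (intro INF_greatest)
    fix n
    have "(\<Inter>n. closure (S0 n) \<inter> (\<Inter>i\<in>I. closure (S i n)))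
        \<subseteq> closure (S0 (Suc n)) \<inter> (\<Inter>i\<in>I. closure (S i (Suc n)))"
      by (rule INF_lower) simp
    also have "\<dots> \<subseteq> S0 n \<inter> (\<Inter>i\<in>I. S i n)"
      by (intro Int_mono INF_superset_mono nbhd_seq_closure S0 S subset_refl)
    finally show "(\<Inter>n. closure (S0 n) \<inter> (\<Inter>i\<in>I. closure (S i n))) \<subseteq> S0 n \<inter> (\<Inter>i\<in>I. S i n)" .
  qed
qed

lemma closed_N: "closed (N I)"
  unfolding N_eq_closures by (intro closed_INT closed_Int ballI closed_closure)

lemma compact_N: "compact (N I)"
proof -
  have "N I = closure (S0 0) \<inter> N I" unfolding N_eq_closures by blast
  then show ?thesis using compact_Int_closed[OF compact_S0 closed_N] by metis
qed

text \<open>The part of \<open>closure (S0 0)\<close> outside \<open>U\<close> is compact and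
  covered by complements of closures of stages. A finite subcover involves finitely many indices,
  and the largest stage serves for all of them.\<close>

lemma outer_base:
  assumes "open U" "N I \<subseteq> U"
  obtains F n where "finite F" "F \<subseteq> I" "B F n \<subseteq> U"
proof -
  \<comment> \<open>Pairing a sequence with a stage treats \<open>S0\<close> and the
    \<open>S i\<close> alike.\<close>
  define C where "C = (\<lambda>(T :: nat \<Rightarrow> 'a set, n). - closure (T n))"
  let ?K = "closure (S0 0) \<inter> - U"
  have "compact ?K" using assms compact_S0 by (intro compact_Int_closed) auto
  moreover have "?K \<subseteq> (\<Union>c \<in> insert S0 (S ` I) \<times> UNIV. C c)"
    using assms(2) unfolding N_eq_closures C_def by fastforce
  moreover have "open (C c)" for c by (auto simp: C_def split: prod.splits)
  ultimately obtain D where D: "D \<subseteq> insert S0 (S ` I) \<times> UNIV" "finite D" "?K \<subseteq> (\<Union>c\<in>D. C c)"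
    by (metis compactE_image)
  \<comment> \<open>\<open>S0\<close> is removed because it is part of every \<open>B F n\<close>
    and so needs no index in \<open>F\<close>.\<close>
  have "finite (fst ` D - {S0})" "fst ` D - {S0} \<subseteq> S ` I" using D by auto
  then obtain F where F: "F \<subseteq> I" "finite F" "fst ` D - {S0} = S ` F"
    using finite_subset_image by metis
  \<comment> \<open>If \<open>D\<close> is empty this value is unspecified, but then
    \<open>?K\<close> is empty and any stage works.\<close>
  define n where "n = Max (snd ` D)"
  have "B F n \<subseteq> U"
  proof (rule subsetI, rule ccontr)
    fix x assume x: "x \<in> B F n" "x \<notin> U"
    have "B F n \<subseteq> closure (S0 0)"
      using B_mono[of F F 0 n] closure_subset by (auto simp: B_def)
    then have "x \<in> ?K" using x by auto
    then obtain T m where Tm: "(T, m) \<in> D" "x \<notin> closure (T m)"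
      using D(3) by (auto simp: C_def)
    then have "m \<le> n" unfolding n_def using D(2) by (auto intro!: Max_ge image_eqI)
    then have "x \<in> B F m" using B_mono[of F F m n] x by auto
    moreover have "T \<in> fst ` D" using Tm(1) by force
    then have "T = S0 \<or> T \<in> S ` F" using F(3) by blast
    ultimately have "x \<in> T m" by (auto simp: B_def)
    then show False using Tm(2) closure_subset by auto
  qed
  then show ?thesis using that F by metis
qed

text \<open>Choose \<open>B F n\<close> so small that its differences, translated by
  \<open>x\<close>, stay in \<open>U\<close>. Density gives \<open>e\<close> with
  \<open>- e + x\<close> in \<open>B F n\<close>, and \<open>e + b\<close> equals \<open>x\<close>
  plus the difference of \<open>- e + x\<close> and \<open>b\<close>.\<close>

lemma dense_translates_base:
  assumes "dense_in euclidean E" "open U" "\<And>n. n \<in> N I \<Longrightarrow> x + n \<in> U"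
  obtains e F n where "e \<in> E" "finite F" "F \<subseteq> I" "x \<in> (+) e ` B F n" "(+) e ` B F n \<subseteq> U"
proof -
  have "- a + b \<in> {y. x + y \<in> U}" if "a \<in> N I" "b \<in> N I" for a b
    using assms(3) N_minus_add that by simp
  from compact_difference_nbhd[OF open_add_vimage(1)[OF assms(2)] compact_N this]
  obtain P where P: "open P" "N I \<subseteq> P" "\<And>a b. a \<in> P \<Longrightarrow> b \<in> P \<Longrightarrow> - a + b \<in> {y. x + y \<in> U}"
    by metis
  obtain F n where F: "finite F" "F \<subseteq> I" "B F n \<subseteq> P"
    using outer_base[OF P(1,2)] by metis
  have "open {e. - e + x \<in> B F n}"
  proof -
    have "open ((\<lambda>e. - e + x) -` B F n)"
      using open_B[OF F(1)] by (intro open_vimage continuous_intros)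
    then show ?thesis by (simp add: vimage_def)
  qed
  moreover have "x \<in> {e. - e + x \<in> B F n}"
    using N_subset_B[OF F(2)] zero_in_N by auto
  ultimately obtain e where e: "e \<in> E" "- e + x \<in> B F n"
    using assms(1) unfolding dense_in_euclidean_iff by blast
  show ?thesis
  proof (rule that[OF e(1) F(1,2)])
    show "x \<in> (+) e ` B F n" using e(2) by (intro image_eqI[where x = "- e + x"]) (auto simp flip: add.assoc)
    show "(+) e ` B F n \<subseteq> U"
    proof safe
      fix b assume "b \<in> B F n"
      then have "x + (- (- e + x) + b) \<in> U" using P(3)[of "- e + x" b] F(3) e(2) by auto
      moreover have "x + (- (- e + x) + b) = e + b" by (simp add: minus_add add.assoc[symmetric])
      ultimately show "e + b \<in> U" by simp
    qed
  qed
qed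

text \<open>For dense \<open>E\<close> this family acts as a base modulo \<open>N I\<close>: it
  suffices for open sets that contain, with the point considered, its whole coset of
  \<open>N I\<close>.\<close>

definition translates :: "'a set \<Rightarrow> 'i set \<Rightarrow> 'a set set" where
  "translates E I = (\<lambda>(e, F, n). (+) e ` B F n) ` (E \<times> Fpow I \<times> UNIV)"

lemma card_translates:
  assumes "infinite E"
  shows "|translates E I| \<le>o |E <+> I|"
proof -
  let ?C = "E <+> I"
  have inf: "infinite ?C" using assms by (simp add: finite_Plus_iff)
  have "|translates E I| \<le>o |E \<times> Fpow I \<times> (UNIV :: nat set)|"
    unfolding translates_def by (rule card_of_image)
  also have "|E \<times> Fpow I \<times> (UNIV :: nat set)| \<le>o |?C|"
  proof (intro card_of_Times_ordLeq_infinite_Field)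
    show "|Fpow I| \<le>o |?C|" using inf card_of_Plus2 by (rule card_Fpow_le)
    show "|UNIV :: nat set| \<le>o |?C|" using inf infinite_iff_card_of_nat by blast
  qed (use inf in \<open>auto simp: Field_card_of card_of_card_order_on card_of_Plus1\<close>)
  finally show ?thesis .
qed

lemma translates_base:
  assumes "dense_in euclidean E" "N I = {0}"
  shows "base_of_topology euclidean (translates E I)"
  unfolding base_of_topology_def
proof safe
  show "openin euclidean V" if "V \<in> translates E I" for V
    using that open_translate(1)[OF open_B] by (auto simp: translates_def Fpow_def)
  fix U :: "'a set" and x assume U: "openin euclidean U" "x \<in> U"
  obtain e F n where "e \<in> E" "finite F" "F \<subseteq> I" "x \<in> (+) e ` B F n" "(+) e ` B F n \<subseteq> U"
    by (rule dense_translates_base[OF assms(1), of U I x]) (use assms U in auto)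
  then show "\<exists>V\<in>translates E I. x \<in> V \<and> V \<subseteq> U"
    unfolding translates_def by (intro bexI[of _ "(+) e ` B F n"] image_eqI[of _ _ "(e, F, n)"]) (auto simp: Fpow_def)
qed

text \<open>If \<open>N I\<close> were trivial, \<open>translates E I\<close> would be a base of
  fewer than \<open>r\<close> sets. This is where the bound by the weight enters the
  construction.\<close>

lemma N_nontrivial:
  fixes E :: "'a set"
  assumes "dense_in euclidean E" "infinite E" "|E| <o r" "|I| <o r" "Card_order r"
    and "r \<le>o weight_card (euclidean :: 'a topology)"
  shows "N I \<noteq> {0}"
proof
  assume "N I = {0}"
  then have "base_of_topology euclidean (translates E I)" using translates_base assms(1) by blast
  then have "weight_card (euclidean :: 'a topology) \<le>o |translates E I|"
    by (metis weight_card_minimiser)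
  also have "|translates E I| \<le>o |E <+> I|" by (rule card_translates[OF assms(2)])
  also have "|E <+> I| <o r"
  proof (rule card_of_Plus_ordLess_infinite_Field[OF _ assms(5,3,4)])
    have "|E| \<le>o |Field r|"
      using assms(3) card_of_Field_ordIso[OF assms(5)]
      by (meson ordIso_symmetric ordLess_imp_ordLeq ordLess_ordIso_trans)
    then show "infinite (Field r)" using assms(2) card_of_ordLeq_infinite by blast
  qed
  finally show False using assms(6) by (meson not_ordLess_ordLeq)
qed

text \<open>The points whose whole coset avoids \<open>closure Q\<close> form an open invariant set
  by compactness of \<open>N I\<close>. If nonempty, it would meet \<open>Q\<close>.\<close>

lemma coset_meets_closure:
  fixes Q :: "'a set"
  assumes "\<And>U. open U \<Longrightarrow> U \<noteq> {} \<Longrightarrow> (\<And>x n. x \<in> U \<Longrightarrow> n \<in> N I \<Longrightarrow> x + n \<in> U) \<Longrightarrow> Q \<inter> U \<noteq> {}"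
  shows "\<exists>n\<in>N I. e + n \<in> closure Q"
proof (rule ccontr)
  assume *: "\<not> ?thesis"
  let ?U = "{y. \<forall>n\<in>N I. y + n \<in> - closure Q}"
  have "open ?U" by (intro open_compact_translate compact_N) auto
  moreover have "e \<in> ?U" using * by blast
  moreover have "x + m \<in> ?U" if "x \<in> ?U" "m \<in> N I" for x m
  proof -
    have "x + (m + n) \<in> - closure Q" if "n \<in> N I" for n
      using \<open>x \<in> ?U\<close> N_add[OF \<open>m \<in> N I\<close> that] by blast
    then show ?thesis by (simp add: add.assoc)
  qed
  ultimately have "Q \<inter> ?U \<noteq> {}" by (intro assms) auto
  then obtain q where "q \<in> Q" "q \<in> ?U" by blast
  then have "q + 0 \<in> - closure Q" using zero_in_N by blast
  then show False using \<open>q \<in> Q\<close> closure_subset by auto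
qed

text \<open>A neighbourhood sequence started inside \<open>S0 0\<close> and the translate of
  \<open>U\<close> to \<open>0\<close> has a stage with closure still inside both; this closure is
  compact and is moved back to \<open>x\<close>.\<close>

lemma compact_neighbourhood:
  fixes U :: "'a set"
  assumes "open U" "x \<in> U"
  obtains V K where "open V" "compact K" "x \<in> V" "V \<subseteq> K" "K \<subseteq> U"
proof -
  have "open ({y. x + y \<in> U} \<inter> S0 0)" "0 \<in> {y. x + y \<in> U} \<inter> S0 0"
    using S0 assms open_add_vimage(1)[OF assms(1), of x] by (auto simp: nbhd_seq_def)
  then obtain T where T: "nbhd_seq T" "T 0 \<subseteq> {y. x + y \<in> U} \<inter> S0 0"
    using nbhd_seq_exists by metis
  let ?C = "closure (T (Suc 0))"
  have C: "?C \<subseteq> {y. x + y \<in> U} \<inter> S0 0" using T nbhd_seq_closure by blast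
  then have "?C = closure (S0 0) \<inter> ?C" using closure_subset by blast
  then have "compact ?C" using compact_Int_closed[OF compact_S0 closed_closure] by metis
  then have K: "compact ((+) x ` ?C)"
    by (intro compact_continuous_image continuous_intros)
  have T': "open (T (Suc 0))" "0 \<in> T (Suc 0)" using T(1) by (auto simp: nbhd_seq_def)
  show ?thesis
  proof (rule that[OF open_translate(1)[OF T'(1)] K])
    show "x \<in> (+) x ` T (Suc 0)" using T'(2) by (intro image_eqI[where x = 0]) auto
    show "(+) x ` T (Suc 0) \<subseteq> (+) x ` ?C" using closure_subset by blast
    show "(+) x ` ?C \<subseteq> U" using C by auto
  qed
qed

text \<open>The set \<open>A\<close> is the complement of \<open>W + N (insert i I)\<close> for a
  small neighbourhood \<open>W\<close> of \<open>0\<close>. A point of a coset of \<open>N I\<close>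
  inside the removed set is shifted out of it with the help of \<open>z\<close>.\<close>

lemma closed_invariant_transversal:
  assumes z: "z \<in> N I" "z \<notin> S i 0"
  obtains A where "closed A" "A \<noteq> UNIV" "\<And>x n. x \<in> A \<Longrightarrow> n \<in> N (insert i I) \<Longrightarrow> x + n \<in> A"
    "\<And>x. \<exists>n\<in>N I. x + n \<in> A"
proof -
  let ?N = "N (insert i I)"
  have "z \<notin> ?N" using z(2) unfolding N_def B_def by blast
  have "open (- ?N)" using closed_N by auto
  \<comment> \<open>This neighbourhood of \<open>0\<close> has to contain all differences
    \<open>- a + b\<close> from \<open>?W\<close>, so that \<open>?W + z\<close> is disjoint from
    \<open>?V\<close>.\<close>
  then have O: "open {y. y + z \<in> - ?N}" by (rule open_add_vimage)
  have "0 \<in> {y. y + z \<in> - ?N}" using \<open>z \<notin> ?N\<close> by simp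
  then obtain T where T: "nbhd_seq T" "T 0 \<subseteq> {y. y + z \<in> - ?N}"
    using nbhd_seq_exists[OF O] by metis
  let ?W = "T (Suc 0)"
  have W: "open ?W" "0 \<in> ?W" using T(1) by (auto simp: nbhd_seq_def)
  have diff: "- a + b + z \<notin> ?N" if "a \<in> ?W" "b \<in> ?W" for a b
  proof -
    have "- a + b \<in> T 0" using T(1) that unfolding nbhd_seq_def by blast
    then show ?thesis using T(2) by blast
  qed
  let ?V = "{w + n | w n. w \<in> ?W \<and> n \<in> ?N}"
  show ?thesis
  proof (rule that[of "- ?V"])
    show "closed (- ?V)" using open_add_set[OF W(1)] by (simp add: closed_def)
    have "0 + 0 \<in> ?V" using W(2) zero_in_N by blast
    then show "- ?V \<noteq> UNIV" by blast
    show "x + n \<in> - ?V" if x: "x \<in> - ?V" and n: "n \<in> ?N" for x n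
    proof
      assume "x + n \<in> ?V"
      then obtain w m where "x + n = w + m" "w \<in> ?W" "m \<in> ?N" by blast
      moreover from this have "x = w + (m + - n)" by (metis add.assoc add_diff_cancel diff_conv_add_uminus)
      moreover have "m + - n \<in> ?N" using N_add N_minus n \<open>m \<in> ?N\<close> by blast
      ultimately show False using x by blast
    qed
    show "\<exists>n\<in>N I. x + n \<in> - ?V" for x
    proof (cases "x \<in> ?V")
      case True
      then obtain w m where w: "x = w + m" "w \<in> ?W" "m \<in> ?N" by blast
      have "w + z \<notin> ?V"
      proof
        assume "w + z \<in> ?V"
        then obtain v k where v: "w + z = v + k" "v \<in> ?W" "k \<in> ?N" by blast
        then have "- v + w + z = k" by (simp add: add.assoc)
        then show False using diff[of v w] w v by simp
      qed
      moreover have "x + (- m + z) = w + z" using w(1) by (simp add: add.assoc)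
      moreover have "- m + z \<in> N I" using w(3) z(1) N_antimono[of I "insert i I"] N_minus_add by blast
      ultimately show ?thesis by (intro bexI[of _ "- m + z"]) auto
    next
      case False
      then show ?thesis using zero_in_N by (intro bexI[of _ 0]) auto
    qed
  qed
qed

end

section \<open>Points avoiding finitely many indices of a chain\<close>

text \<open>The group reached before stage \<open>i\<close> is \<open>N (underS r i)\<close>, the
  next one is \<open>N (insert i (underS r i))\<close>; limit stages need no separate
  treatment.\<close>

locale nbhd_seq_chain = nbhd_seq_family S0 S
  for S0 :: "nat \<Rightarrow> 'a::{topological_group_add, t2_space} set"
    and S :: "'i \<Rightarrow> nat \<Rightarrow> 'a set" +
  fixes r :: "'i rel" and A :: "'i \<Rightarrow> 'a set"
  assumes wo: "Well_order r"
    and closed_A: "i \<in> Field r \<Longrightarrow> closed (A i)"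
    and A_add: "i \<in> Field r \<Longrightarrow> x \<in> A i \<Longrightarrow> n \<in> N (insert i (underS r i)) \<Longrightarrow> x + n \<in> A i"
    and A_meets: "i \<in> Field r \<Longrightarrow> \<exists>n\<in>N (underS r i). x + n \<in> A i"
begin

lemma underS_trans: "i \<in> underS r j \<Longrightarrow> j \<in> underS r k \<Longrightarrow> i \<in> underS r k"
proof -
  assume "i \<in> underS r j" "j \<in> underS r k"
  then have *: "(i, j) \<in> r" "i \<noteq> j" "(j, k) \<in> r" by (auto simp: underS_def)
  moreover have "trans r" "antisym r" using wo by (auto simp: order_on_defs)
  ultimately have "(i, k) \<in> r" "i \<noteq> k" by (blast dest: transD antisymD)+
  then show "i \<in> underS r k" by (simp add: underS_def)
qed

lemma underS_linear: "i \<in> Field r \<Longrightarrow> j \<in> Field r \<Longrightarrow> i \<noteq> j \<Longrightarrow> i \<in> underS r j \<or> j \<in> underS r i"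
  using wo by (auto simp: underS_def well_order_on_def linear_order_on_def total_on_def)

lemma ex_underS_max:
  assumes "finite J" "J \<noteq> {}" "J \<subseteq> Field r"
  shows "\<exists>m\<in>J. J - {m} \<subseteq> underS r m"
  using assms
proof (induction J rule: finite_ne_induct)
  case (insert x J)
  then obtain m where m: "m \<in> J" "J - {m} \<subseteq> underS r m" by auto
  have "x \<noteq> m" using insert m by auto
  then consider "x \<in> underS r m" | "m \<in> underS r x"
    using underS_linear insert.prems m by blast
  then show ?case
  proof cases
    case 1
    then show ?thesis using m by auto
  next
    case 2
    then have "J \<subseteq> underS r x" using m underS_trans by blast
    then show ?thesis by auto
  qed
qed auto

text \<open>A common name for the empty set, the whole field and the segments below or up to an
  index, so that each argument is given only once.\<close>

definition initial :: "'i set \<Rightarrow> bool" where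
  "initial I \<longleftrightarrow> I \<subseteq> Field r \<and> (\<forall>i\<in>I. underS r i \<subseteq> I)"

lemma initial_Field: "initial (Field r)"
  by (auto simp: initial_def underS_Field)

lemma initial_empty: "initial {}"
  by (auto simp: initial_def)

lemma initial_underS: "initial (underS r k)"
  unfolding initial_def using underS_trans underS_Field[of _ r k] by blast

lemma initial_insert_underS: "k \<in> Field r \<Longrightarrow> initial (insert k (underS r k))"
  using initial_underS[of k] by (auto simp: initial_def)

lemma A_add_initial:
  assumes "initial I" "i \<in> I" "x \<in> A i" "n \<in> N I"
  shows "x + n \<in> A i"
proof -
  have "insert i (underS r i) \<subseteq> I" "i \<in> Field r" using assms by (auto simp: initial_def)
  then show ?thesis using A_add N_antimono assms by blast
qed

text \<open>Handling the indices in increasing order works because the corrections made for an index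
  are invisible to the smaller ones.\<close>

lemma coset_meets_finitely_many:
  assumes "initial I" "finite J" "J \<subseteq> Field r - I"
  shows "\<exists>n\<in>N I. \<forall>j\<in>J. x + n \<in> A j"
  using assms(2,3)
proof (induction J rule: finite_psubset_induct)
  case (psubset J)
  show ?case
  proof (cases "J = {}")
    case True
    then show ?thesis using zero_in_N by auto
  next
    case False
    then obtain m where m: "m \<in> J" "J - {m} \<subseteq> underS r m"
      using ex_underS_max[OF psubset.hyps(1) False] psubset.prems by blast
    obtain n where n: "n \<in> N I" "\<forall>j\<in>J - {m}. x + n \<in> A j"
      using psubset.IH[of "J - {m}"] psubset.prems m(1) by blast
    have mF: "m \<in> Field r" "m \<notin> I" using m psubset.prems by auto
    obtain n' where n': "n' \<in> N (underS r m)" "x + n + n' \<in> A m"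
      using A_meets[OF mF(1)] by blast
    \<comment> \<open>An index outside the initial set \<open>I\<close> lies above all of it, so the
      correction \<open>n'\<close> still belongs to \<open>N I\<close>.\<close>
    have "I \<subseteq> underS r m"
    proof
      fix i assume "i \<in> I"
      then have "i \<in> Field r" "i \<noteq> m" "m \<notin> underS r i"
        using assms(1) mF by (auto simp: initial_def)
      then show "i \<in> underS r m" using underS_linear mF by blast
    qed
    then have "n + n' \<in> N I" using N_add N_antimono n n' by blast
    moreover have "x + (n + n') \<in> A j" if "j \<in> J" for j
    proof (cases "j = m")
      case True
      then show ?thesis using n' by (simp add: add.assoc)
    next
      case False
      then have "x + n + n' \<in> A j"
        using A_add_initial[OF initial_underS, of j m "x + n" n'] that m n n' by blast
      then show ?thesis by (simp add: add.assoc)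
    qed
    ultimately show ?thesis by blast
  qed
qed

text \<open>By compactness \<open>U\<close> contains a coset of \<open>N H\<close> for a finite \<open>H \<subseteq> I\<close>.  Giving up the largest
  \<open>k \<in> H\<close> leaves only the problem of staying in the saturation of \<open>U\<close> below \<open>k\<close>.\<close>

lemma finite_avoidance_step:
  assumes I: "initial I"
    and IH: "\<And>k U. k \<in> I \<Longrightarrow> open U \<Longrightarrow> U \<noteq> {} \<Longrightarrow> (\<And>x n. x \<in> U \<Longrightarrow> n \<in> N (underS r k) \<Longrightarrow> x + n \<in> U) \<Longrightarrow>
      \<exists>F. finite F \<and> (\<forall>J. finite J \<and> J \<subseteq> underS r k - F \<longrightarrow> (\<exists>x\<in>U. \<forall>j\<in>J. x \<in> A j))"
    and U: "open U" "U \<noteq> {}" "\<And>x n. x \<in> U \<Longrightarrow> n \<in> N I \<Longrightarrow> x + n \<in> U"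
  shows "\<exists>F. finite F \<and> (\<forall>J. finite J \<and> J \<subseteq> I - F \<longrightarrow> (\<exists>x\<in>U. \<forall>j\<in>J. x \<in> A j))"
proof -
  obtain x0 where x0: "x0 \<in> U" using U by auto
  have "N I \<subseteq> {y. x0 + y \<in> U}" using U(3) x0 by auto
  then obtain H m where H: "finite H" "H \<subseteq> I" "B H m \<subseteq> {y. x0 + y \<in> U}"
    using outer_base[OF open_add_vimage(1)[OF U(1)]] by metis
  then have NH: "x0 + n \<in> U" if "n \<in> N H" for n
    using N_subset_B[of H H m] that by auto
  show ?thesis
  proof (cases "H = {}")
    case True
    \<comment> \<open>The whole coset of \<open>N {}\<close> through \<open>x0\<close> lies in
      \<open>U\<close>, so no index has to be given up.\<close>
    have "\<exists>x\<in>U. \<forall>j\<in>J. x \<in> A j" if "finite J" "J \<subseteq> I" for J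
    proof -
      have "\<exists>n\<in>N {}. \<forall>j\<in>J. x0 + n \<in> A j"
        using coset_meets_finitely_many[OF initial_empty] that I by (auto simp: initial_def)
      then show ?thesis using NH True by blast
    qed
    then show ?thesis by (intro exI[of _ "{}"]) auto
  next
    case False
    have IF: "I \<subseteq> Field r" using I by (auto simp: initial_def)
    then obtain k where k: "k \<in> H" "H - {k} \<subseteq> underS r k"
      using ex_underS_max[OF H(1) False] H by blast
    let ?K = "insert k (underS r k)"
    have kI: "k \<in> I" "k \<in> Field r" using k H IF by auto
    have K: "initial ?K" using initial_insert_underS kI by auto
    have NK: "N ?K \<subseteq> N H" using k by (intro N_antimono) auto
    \<comment> \<open>Points of \<open>?U1\<close> may still be corrected by \<open>N ?K\<close>
      without leaving \<open>U\<close>. Saturating to \<open>?U2\<close> supplies the invariance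
      that the induction hypothesis requires.\<close>
    let ?U1 = "{y. \<forall>n\<in>N ?K. y + n \<in> U}"
    let ?U2 = "{y + n | y n. y \<in> ?U1 \<and> n \<in> N (underS r k)}"
    have U2: "open ?U2"
      using open_add_set[OF open_compact_translate[OF U(1) compact_N]] by blast
    have "x0 \<in> ?U1" using NH NK by auto
    then have "x0 + 0 \<in> ?U2" using zero_in_N by blast
    then have ne: "?U2 \<noteq> {}" by blast
    have inv: "x + n \<in> ?U2" if x: "x \<in> ?U2" and n: "n \<in> N (underS r k)" for x n
    proof -
      obtain y n' where y: "x = y + n'" "y \<in> ?U1" "n' \<in> N (underS r k)" using x by blast
      then have "x + n = y + (n' + n)" "n' + n \<in> N (underS r k)"
        using n N_add by (auto simp: add.assoc)
      then show ?thesis using y(2) by blast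
    qed
    from IH[OF kI(1) U2 ne inv] obtain F where F: "finite F \<and>
      (\<forall>J. finite J \<and> J \<subseteq> underS r k - F \<longrightarrow> (\<exists>x\<in>?U2. \<forall>j\<in>J. x \<in> A j))" by (rule exE)
    have "\<exists>x\<in>U. \<forall>j\<in>J. x \<in> A j" if J: "finite J" "J \<subseteq> I - insert k F" for J
    proof -
      obtain x where x: "x \<in> ?U2" "\<forall>j\<in>J \<inter> underS r k. x \<in> A j"
        using F[THEN conjunct2, rule_format, of "J \<inter> underS r k"] J by blast
      then obtain y n where y: "x = y + n" "y \<in> ?U1" "n \<in> N (underS r k)" by blast
      have yA: "y \<in> A j" if "j \<in> J \<inter> underS r k" for j
      proof -
        have "x + - n \<in> A j"
          using A_add_initial[OF initial_underS] x that N_minus[OF y(3)] by blast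
        then show ?thesis using y by (simp add: add.assoc)
      qed
      \<comment> \<open>Indices above \<open>k\<close> are handled last: \<open>n'\<close> keeps the
        point in \<open>U\<close> and disturbs no index below \<open>k\<close>.\<close>
      obtain n' where n': "n' \<in> N ?K" "\<forall>j\<in>J - underS r k. y + n' \<in> A j"
        using coset_meets_finitely_many[OF K, of "J - underS r k" y] J IF by blast
      have "y + n' \<in> A j" if "j \<in> J" for j
      proof (cases "j \<in> underS r k")
        case True
        then show ?thesis using A_add_initial[OF K _ yA n'(1)] that by blast
      next
        case False
        then show ?thesis using n' that by blast
      qed
      moreover have "y + n' \<in> U" using y n' by blast
      ultimately show ?thesis by blast
    qed
    then show ?thesis using F by (intro exI[of _ "insert k F"]) auto
  qed
qed

text \<open>Well-founded induction along \<open>r\<close> settles every proper segment; one more use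
  of the step passes to the whole field.\<close>

lemma finite_avoidance:
  assumes U: "open U" "U \<noteq> {}" "\<And>x n. x \<in> U \<Longrightarrow> n \<in> N (Field r) \<Longrightarrow> x + n \<in> U"
  shows "\<exists>F. finite F \<and> (\<forall>J. finite J \<and> J \<subseteq> Field r - F \<longrightarrow> (\<exists>x\<in>U. \<forall>j\<in>J. x \<in> A j))"
proof (rule finite_avoidance_step[OF initial_Field _ U])
  have wf: "wf (r - Id)" using wo by (simp add: well_order_on_def)
  fix k and V :: "'a set" assume "open V" "V \<noteq> {}"
    "\<And>x n. x \<in> V \<Longrightarrow> n \<in> N (underS r k) \<Longrightarrow> x + n \<in> V"
  with wf show "\<exists>F. finite F \<and> (\<forall>J. finite J \<and> J \<subseteq> underS r k - F \<longrightarrow> (\<exists>x\<in>V. \<forall>j\<in>J. x \<in> A j))"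
  proof (induction k arbitrary: V rule: wf_induct_rule)
    case (less k)
    show ?case
    proof (rule finite_avoidance_step[OF initial_underS _ less.prems])
      fix j and W :: "'a set"
      assume "j \<in> underS r k" "open W" "W \<noteq> {}"
        "\<And>x n. x \<in> W \<Longrightarrow> n \<in> N (underS r j) \<Longrightarrow> x + n \<in> W"
      then show "\<exists>F. finite F \<and> (\<forall>J. finite J \<and> J \<subseteq> underS r j - F \<longrightarrow> (\<exists>x\<in>W. \<forall>i\<in>J. x \<in> A i))"
        by (intro less.IH) (auto simp: underS_def)
    qed
  qed
qed

section \<open>The dense set of points missing only finitely many \<open>A i\<close>\<close>

definition P :: "'a set" where
  "P = {x. finite {i \<in> Field r. x \<notin> A i}}"

lemma P_add:
  assumes "x \<in> P" "n \<in> N (Field r)"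
  shows "x + n \<in> P"
proof -
  have "{i \<in> Field r. x + n \<notin> A i} \<subseteq> {i \<in> Field r. x \<notin> A i}"
    using A_add_initial[OF initial_Field _ _ assms(2)] by blast
  then show ?thesis using assms(1) finite_subset by (auto simp: P_def)
qed

text \<open>Compactness upgrades finite avoidance to a single point of
  \<open>K + N (Field r)\<close> in all remaining \<open>A i\<close>. Invariance of \<open>P\<close>
  then allows moving it back into \<open>K\<close>.\<close>

lemma dense_P: "dense_in euclidean P"
  unfolding dense_in_euclidean_iff
proof (intro allI impI)
  fix U :: "'a set" assume "open U \<and> U \<noteq> {}"
  then obtain x where U: "open U" "x \<in> U" by blast
  obtain V K where V: "open V" "compact K" "x \<in> V" "V \<subseteq> K" "K \<subseteq> U"
    using compact_neighbourhood[OF U] .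
  let ?N = "N (Field r)"
  let ?V = "{y + n | y n. y \<in> V \<and> n \<in> ?N}"
  have "open ?V" using open_add_set[OF V(1)] .
  moreover have "x + 0 \<in> ?V" using V zero_in_N by blast
  moreover have "y + n \<in> ?V" if y: "y \<in> ?V" and n: "n \<in> ?N" for y n
  proof -
    obtain v n' where "y = v + n'" "v \<in> V" "n' \<in> ?N" using y by blast
    then have "y + n = v + (n' + n)" "n' + n \<in> ?N" "v \<in> V"
      using n N_add by (auto simp: add.assoc)
    then show ?thesis by blast
  qed
  ultimately have "\<exists>F. finite F \<and> (\<forall>J. finite J \<and> J \<subseteq> Field r - F \<longrightarrow> (\<exists>x\<in>?V. \<forall>j\<in>J. x \<in> A j))"
    by (intro finite_avoidance) auto
  then obtain F where F: "finite F \<and>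
    (\<forall>J. finite J \<and> J \<subseteq> Field r - F \<longrightarrow> (\<exists>x\<in>?V. \<forall>j\<in>J. x \<in> A j))" by (rule exE)
  let ?K = "(\<lambda>(y, n). y + n) ` (K \<times> ?N)"
  have "compact ?K"
    using V(2) compact_N unfolding case_prod_unfold
    by (intro compact_continuous_image continuous_intros compact_Times)
  \<comment> \<open>\<open>F\<close> was fixed before \<open>J\<close>, so the finite intersection
    property covers all indices outside \<open>F\<close> at once.\<close>
  then have "?K \<inter> (\<Inter>i\<in>Field r - F. A i) \<noteq> {}"
  proof (rule compact_imp_fip_image)
    show "closed (A i)" if "i \<in> Field r - F" for i using closed_A that by blast
    fix J assume "finite J" "J \<subseteq> Field r - F"
    then obtain y where "y \<in> ?V" "\<forall>j\<in>J. y \<in> A j"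
      using F[THEN conjunct2, rule_format, of J] by blast
    moreover have "?V \<subseteq> ?K" using V(4) by auto
    ultimately show "?K \<inter> (\<Inter>i\<in>J. A i) \<noteq> {}" by blast
  qed
  then obtain y n where y: "y \<in> K" "n \<in> ?N" "\<And>i. i \<in> Field r - F \<Longrightarrow> y + n \<in> A i"
    by auto
  have "{i \<in> Field r. y + n \<notin> A i} \<subseteq> F" using y by blast
  then have "y + n \<in> P" using F finite_subset by (auto simp: P_def)
  then have "y + n + - n \<in> P" using P_add N_minus y by blast
  then have "y \<in> P" by (simp add: add.assoc)
  then show "P \<inter> U \<noteq> {}" using V(5) y(1) by blast
qed

lemma small_dense_subset_of_P:
  fixes E :: "'a set"
  assumes E: "dense_in euclidean E" "infinite E" "|E| \<le>o r" and r: "Card_order r" "infinite (Field r)"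
  obtains D where "D \<subseteq> P" "dense_in euclidean D" "|D| \<le>o r"
proof -
  let ?N = "N (Field r)"
  define T where "T = {V \<in> translates E (Field r). V \<inter> P \<noteq> {}}"
  define q where "q V = (SOME x. x \<in> V \<inter> P)" for V
  have q: "q V \<in> V \<inter> P" if "V \<in> T" for V
  proof -
    have "\<exists>x. x \<in> V \<inter> P" using that by (auto simp: T_def)
    then show ?thesis unfolding q_def by (rule someI_ex)
  qed
  define Q where "Q = q ` T"
  have QP: "Q \<subseteq> P" using q by (auto simp: Q_def)
  have rF: "|Field r| \<le>o r" using card_of_Field_ordIso[OF r(1)] ordIso_iff_ordLeq by blast
  have "|Q| \<le>o |T|" unfolding Q_def by (rule card_of_image)
  also have "|T| \<le>o |translates E (Field r)|" by (rule card_of_mono1) (auto simp: T_def)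
  also have "|translates E (Field r)| \<le>o |E <+> Field r|" by (rule card_translates[OF E(2)])
  also have "|E <+> Field r| \<le>o r" by (rule card_of_Plus_ordLeq_infinite_Field[OF r(2) E(3) rF r(1)])
  finally have card_Q: "|Q| \<le>o r" .
  have meets: "Q \<inter> U \<noteq> {}"
    if U: "open U" "U \<noteq> {}" "\<And>x n. x \<in> U \<Longrightarrow> n \<in> ?N \<Longrightarrow> x + n \<in> U" for U
  proof -
    obtain x where x: "x \<in> P" "x \<in> U" using dense_P U(1,2) unfolding dense_in_euclidean_iff by blast
    obtain e F n where V: "e \<in> E" "finite F" "F \<subseteq> Field r" "x \<in> (+) e ` B F n" "(+) e ` B F n \<subseteq> U"
      by (rule dense_translates_base[OF E(1) U(1), of "Field r" x]) (use U(3) x in auto)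
    then have "(+) e ` B F n \<in> T"
      unfolding T_def translates_def using x
      by (auto simp: Fpow_def intro!: image_eqI[of _ _ "(e, F, n)"])
    then have "q ((+) e ` B F n) \<in> Q \<inter> U" using q V(5) by (auto simp: Q_def)
    then show ?thesis by blast
  qed
  have "\<forall>e. \<exists>n. n \<in> ?N \<and> e + n \<in> closure Q" using coset_meets_closure[OF meets] by blast
  then obtain n where n: "\<And>e. n e \<in> ?N" "\<And>e. e + n e \<in> closure Q" by metis
  \<comment> \<open>Since \<open>e + n e\<close> is in \<open>closure Q\<close>, the translate of
    \<open>Q\<close> by \<open>- n e\<close> accumulates at \<open>e\<close>; it stays in
    \<open>P\<close> because \<open>n e\<close> is in \<open>?N\<close>.\<close>
  let ?D = "(\<lambda>(x, e). x + - n e) ` (Q \<times> E)"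
  show ?thesis
  proof (rule that)
    show "?D \<subseteq> P" using P_add[OF _ N_minus[OF n(1)]] QP by auto
    show "dense_in euclidean ?D"
      unfolding dense_in_euclidean_iff
    proof (intro allI impI)
      fix U :: "'a set" assume U: "open U \<and> U \<noteq> {}"
      then obtain e where e: "e \<in> E" "e \<in> U" using E(1) unfolding dense_in_euclidean_iff by blast
      have "open {y. y + - n e \<in> U}" using U open_add_vimage(2) by blast
      moreover have "e + n e \<in> {y. y + - n e \<in> U}" using e by (simp add: add.assoc)
      ultimately obtain x where "x \<in> Q" "x + - n e \<in> U"
        using n(2)[of e] unfolding closure_iff_nhds_not_empty by blast
      then show "?D \<inter> U \<noteq> {}" using e(1) by blast
    qed
    have "|?D| \<le>o |Q \<times> E|" by (rule card_of_image)
    also have "|Q \<times> E| \<le>o r" using card_of_Times_ordLeq_infinite_Field[OF r(2) card_Q E(3) r(1)] .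
    finally show "|?D| \<le>o r" .
  qed
qed

text \<open>Each point of \<open>D\<close> fails at finitely many indices, so fewer than
  \<open>r\<close> points leave some index \<open>i\<close> at which none fails. Then
  \<open>D\<close> lies in the closed proper set \<open>A i\<close>.\<close>

lemma dense_subset_of_P_large:
  fixes D :: "'a set"
  assumes "Card_order r" "infinite (Field r)" "\<And>i. i \<in> Field r \<Longrightarrow> A i \<noteq> UNIV"
    "D \<subseteq> P" "dense_in euclidean D"
  shows "r \<le>o |D|"
proof (rule ccontr)
  assume "\<not> r \<le>o |D|"
  then have less: "|D| <o r"
    using not_ordLeq_iff_ordLess assms(1) card_of_Well_order card_order_on_well_order_on by blast
  let ?H = "\<lambda>d. {i \<in> Field r. d \<notin> A i}"
  have fin: "finite (?H d)" if "d \<in> D" for d using that assms(4) by (auto simp: P_def)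
  have rF: "|Field r| =o r" using card_of_Field_ordIso[OF assms(1)] .
  have "\<not> Field r \<subseteq> (\<Union>d\<in>D. ?H d)"
  proof
    assume sub: "Field r \<subseteq> (\<Union>d\<in>D. ?H d)"
    then have "infinite (\<Union>d\<in>D. ?H d)" using assms(2) finite_subset by blast
    then have inf: "infinite D" using fin by blast
    have "|\<Union>d\<in>D. ?H d| \<le>o |D|"
    proof (rule card_of_UNION_ordLeq_infinite[OF inf])
      show "|D| \<le>o |D|" by (rule card_of_mono1) simp
      show "\<forall>d\<in>D. |?H d| \<le>o |D|"
        using fin inf by (meson card_of_Well_order card_of_ordLeq_finite ordLeq_total)
    qed
    then have "|Field r| \<le>o |D|" using card_of_mono1[OF sub] ordLeq_transitive by blast
    then show False using less rF
      by (meson not_ordLess_ordIso ordLeq_ordLess_trans)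
  qed
  then obtain i where i: "i \<in> Field r" "D \<subseteq> A i" by blast
  have "open (- A i)" "- A i \<noteq> {}" using closed_A[OF i(1)] assms(3)[OF i(1)] by auto
  then show False using assms(5) i(2) unfolding dense_in_euclidean_iff by blast
qed

end

text \<open>Recursion along \<open>r\<close>: fewer than \<open>r\<close> sequences precede stage
  \<open>i\<close>, so their group still contains some nonzero \<open>z\<close>, and the new
  sequence is chosen to exclude it.\<close>

lemma exists_chain:
  fixes r :: "'b rel" and E :: "'a::{topological_group_add, t2_space} set"
  assumes S0: "nbhd_seq S0" "compact (closure (S0 0))"
    and E: "dense_in euclidean E" "infinite E" "|E| <o r"
    and r: "Card_order r" "r \<le>o weight_card (euclidean :: 'a topology)"
  obtains S :: "'b \<Rightarrow> nat \<Rightarrow> 'a set" and A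
  where "nbhd_seq_chain S0 S r A" "\<And>i. i \<in> Field r \<Longrightarrow> A i \<noteq> UNIV"
proof -
  \<comment> \<open>The condition consults \<open>f\<close> only below \<open>i\<close>, as
    well-founded choice demands; \<open>z\<close> witnesses that the group shrinks strictly at stage
    \<open>i\<close>.\<close>
  define ok where "ok f i T \<longleftrightarrow> nbhd_seq T \<and> (i \<in> Field r \<longrightarrow>
      (\<exists>z. (\<forall>n. z \<in> S0 n \<and> (\<forall>j\<in>underS r i. z \<in> f j n)) \<and> z \<notin> T 0))"
    for f :: "'b \<Rightarrow> nat \<Rightarrow> 'a set" and i T
  have wo: "Well_order r" using r(1) by (simp add: card_order_on_well_order_on)
  have "\<exists>S. \<forall>i. ok S i (S i)"
  proof (rule dependent_wf_choice)
    show "wf (r - Id)" using wo by (simp add: well_order_on_def)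
    show "ok f i T = ok g i T" if "\<And>j. (j, i) \<in> r - Id \<Longrightarrow> f j = g j" for f g i T
    proof -
      have "\<forall>j\<in>underS r i. f j = g j" using that by (auto simp: underS_def)
      then show ?thesis unfolding ok_def by simp
    qed
    show "\<exists>T. ok f i T" if f: "\<And>j. (j, i) \<in> r - Id \<Longrightarrow> ok f j (f j)" for i f
    proof (cases "i \<in> Field r")
      case True
      \<comment> \<open>Only values of \<open>f\<close> below \<open>i\<close> are known to be
        neighbourhood sequences; the default \<open>S0\<close> elsewhere does not affect
        \<open>N (underS r i)\<close>.\<close>
      define g where "g j = (if j \<in> underS r i then f j else S0)" for j
      have "nbhd_seq (g j)" for j
        using f[of j] S0 by (auto simp: g_def ok_def underS_def)
      then interpret nbhd_seq_family S0 g
        using S0 by unfold_locales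
      have "N (underS r i) \<noteq> {0}"
        using N_nontrivial[OF E card_of_underS[OF r(1) True] r] .
      then obtain z where z: "z \<in> N (underS r i)" "z \<noteq> 0" using zero_in_N by blast
      have "open (- {z})" "0 \<in> - {z}" using z by auto
      then obtain T where T: "nbhd_seq T" "T 0 \<subseteq> - {z}" using nbhd_seq_exists by metis
      have "\<forall>n. z \<in> S0 n \<and> (\<forall>j\<in>underS r i. z \<in> f j n)"
        using z(1) by (auto simp: N_def B_def g_def)
      then show ?thesis using T unfolding ok_def by blast
    next
      case False
      then show ?thesis using S0 unfolding ok_def by blast
    qed
  qed
  then obtain S where ok: "\<And>i. ok S i (S i)" by blast
  then interpret nbhd_seq_family S0 S
    using S0 by unfold_locales (auto simp: ok_def)
  define good where "good i A \<longleftrightarrow> closed A \<and> A \<noteq> UNIV \<and>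
      (\<forall>x n. x \<in> A \<and> n \<in> N (insert i (underS r i)) \<longrightarrow> x + n \<in> A) \<and>
      (\<forall>x. \<exists>n\<in>N (underS r i). x + n \<in> A)" for i A
  have "\<exists>A. good i A" if i: "i \<in> Field r" for i
  proof -
    obtain z where "\<forall>n. z \<in> S0 n \<and> (\<forall>j\<in>underS r i. z \<in> S j n)" "z \<notin> S i 0"
      using ok[of i] i unfolding ok_def by blast
    then have "z \<in> N (underS r i)" "z \<notin> S i 0" by (auto simp: N_def B_def)
    then show ?thesis
      using closed_invariant_transversal[of z "underS r i" i] unfolding good_def by metis
  qed
  then obtain A where A: "\<And>i. i \<in> Field r \<Longrightarrow> good i (A i)" by metis
  show ?thesis
  proof
    show "nbhd_seq_chain S0 S r A"
      by unfold_locales (use A wo in \<open>auto simp: good_def\<close>)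
    show "A i \<noteq> UNIV" if "i \<in> Field r" for i using A[OF that] by (simp add: good_def)
  qed
qed

section \<open>The spectrum of a locally compact group\<close>

lemma locally_compact_nbhd_seq:
  assumes "locally_compact_space (euclidean :: 'a::{topological_group_add, t2_space} topology)"
  obtains S :: "nat \<Rightarrow> 'a::{topological_group_add, t2_space} set" where "nbhd_seq S" "compact (closure (S 0))"
proof -
  obtain U K :: "'a set" where U: "open U" "0 \<in> U" and K: "compact K" "U \<subseteq> K"
    using assms unfolding locally_compact_space_def by (auto dest: spec[of _ 0])
  obtain S where S: "nbhd_seq S" "S 0 \<subseteq> U" using nbhd_seq_exists[OF U] .
  have "closure (S 0) \<subseteq> K" using S K by (intro closure_minimal compact_imp_closed) auto
  then have "closure (S 0) = K \<inter> closure (S 0)" by blast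
  then have "compact (closure (S 0))" using compact_Int_closed[OF K(1) closed_closure] by metis
  then show ?thesis using that S by blast
qed

text \<open>A finite dense set in a T1 space is the whole space, whose singletons then form a base.
  Excluding this makes infinite cardinal arithmetic available.\<close>

lemma infinite_if_density_less_weight:
  assumes "dense_in (euclidean :: 'a::t1_space topology) E"
    and "|E| <o weight_card (euclidean :: 'a topology)"
  shows "infinite E"
proof
  assume "finite E"
  then have E: "E = UNIV" using dense_in_euclidean_finite assms(1) by blast
  have "weight_card (euclidean :: 'a topology) \<le>o |range (\<lambda>x::'a. {x})|"
    using base_of_finite_t1 \<open>finite E\<close> E by (metis weight_card_minimiser)
  also have "|range (\<lambda>x::'a. {x})| \<le>o |UNIV :: 'a set|" by (rule card_of_image)
  finally show False using assms(2) E by (meson not_ordLess_ordLeq)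
qed

lemma exists_dense_of_density:
  fixes r :: "'b rel"
  assumes lc: "locally_compact_space (euclidean :: 'a::{topological_group_add, t2_space} topology)"
    and r: "Card_order r" "density_card (euclidean :: 'a topology) <o r"
      "r \<le>o weight_card (euclidean :: 'a topology)"
  obtains D :: "'a::{topological_group_add, t2_space} set" where "dense_in euclidean D" "density_card (subtopology euclidean D) =o r"
proof -
  obtain E :: "'a set" where E: "dense_in euclidean E" "density_card (euclidean :: 'a topology) = |E|"
    using density_card_minimiser by metis
  have Er: "|E| <o r" using r(2) E(2) by simp
  have inf: "infinite E"
    using infinite_if_density_less_weight[OF E(1)] ordLess_ordLeq_trans[OF Er r(3)] by blast
  have "|E| \<le>o |Field r|"
    using Er card_of_Field_ordIso[OF r(1)]
    by (meson ordIso_symmetric ordLess_imp_ordLeq ordLess_ordIso_trans)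
  then have infr: "infinite (Field r)" using inf card_of_ordLeq_infinite by blast
  obtain S0 :: "nat \<Rightarrow> 'a set" where S0: "nbhd_seq S0" "compact (closure (S0 0))"
    using locally_compact_nbhd_seq[OF lc] .
  obtain S :: "'b \<Rightarrow> nat \<Rightarrow> 'a set" and A where
    chain: "nbhd_seq_chain S0 S r A" and A: "\<And>i. i \<in> Field r \<Longrightarrow> A i \<noteq> UNIV"
    using exists_chain[OF S0 E(1) inf Er r(1,3)] by metis
  interpret nbhd_seq_chain S0 S r A by (rule chain)
  obtain D where D: "D \<subseteq> P" "dense_in euclidean D" "|D| \<le>o r"
    using small_dense_subset_of_P[OF E(1) inf ordLess_imp_ordLeq[OF Er] r(1) infr] .
  \<comment> \<open>A smallest dense subset of \<open>D\<close> is also dense in the group and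
    contained in \<open>P\<close>, so the lower bound applies to it.\<close>
  obtain D' where D': "dense_in (subtopology euclidean D) D'"
    "density_card (subtopology euclidean D) = |D'|"
    using density_card_minimiser by metis
  have sub: "D' \<subseteq> D" "dense_in euclidean D'"
    using D'(1) dense_in_subtopology_iff[OF D(2)] by auto
  have "r \<le>o |D'|"
    using dense_subset_of_P_large[OF r(1) infr A _ sub(2)] sub(1) D(1) by blast
  moreover have "|D'| \<le>o r" using card_of_mono1[OF sub(1)] D(3) ordLeq_transitive by blast
  ultimately have "density_card (subtopology euclidean D) =o r"
    unfolding D'(2) ordIso_iff_ordLeq by blast
  then show ?thesis using that D(2) by blast
qed

theorem mainTheorem2:
  assumes "locally_compact_space (euclidean :: 'a::{topological_group_add, t2_space} topology)"
  shows "(dd_spectrum (euclidean :: 'a topology) :: 'b rel set) =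
    card_interval (density_card (euclidean :: 'a topology)) (weight_card (euclidean :: 'a topology))"
proof (intro equalityI subsetI)
  fix r :: "'b rel"
  assume "r \<in> dd_spectrum (euclidean :: 'a topology)"
  then obtain D :: "'a set" where r: "Card_order r" "dense_in euclidean D"
    "density_card (subtopology euclidean D) =o r"
    by (auto simp: dd_spectrum_def)
  have "density_card (euclidean :: 'a topology) \<le>o r"
    using density_card_le_subtopology[OF r(2)] r(3) ordLeq_ordIso_trans by blast
  moreover have "r \<le>o weight_card (euclidean :: 'a topology)"
    using ordIso_ordLeq_trans[OF ordIso_symmetric[OF r(3)] density_card_subtopology_le_weight[OF r(2)]] .
  ultimately show "r \<in> card_interval (density_card (euclidean :: 'a topology))
      (weight_card (euclidean :: 'a topology))"
    using r(1) by (simp add: card_interval_def)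
next
  fix r :: "'b rel"
  assume "r \<in> card_interval (density_card (euclidean :: 'a topology))
      (weight_card (euclidean :: 'a topology))"
  then have r: "Card_order r" "density_card (euclidean :: 'a topology) \<le>o r"
    "r \<le>o weight_card (euclidean :: 'a topology)"
    by (auto simp: card_interval_def)
  have "\<exists>D :: 'a set. dense_in euclidean D \<and> density_card (subtopology euclidean D) =o r"
  \<comment> \<open>The group itself attains the lower end; the construction needs a dense set of
    fewer than \<open>r\<close> points.\<close>
  proof (cases "density_card (euclidean :: 'a topology) =o r")
    case True
    then show ?thesis
      using dense_in_topspace[of "euclidean :: 'a topology"] by (intro exI[of _ UNIV]) auto
  next
    case False
    then have "density_card (euclidean :: 'a topology) <o r"
      using r(2) ordLeq_iff_ordLess_or_ordIso by blast
    then show ?thesis using exists_dense_of_density[OF assms r(1) _ r(3)] by metis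
  qed
  then show "r \<in> dd_spectrum (euclidean :: 'a topology)"
    using r(1) by (simp add: dd_spectrum_def)
qed

end
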